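(* (1) Let $X_1,X_2$ be arbitrarily dependent random variables with distributions $F_1,F_2\in\mathcal{P_D}$ respectively. Then for any $p\in(0,1)$, $pF_1+(1-p)F_2\in\mathcal{P_D}$. (2) Let $X_1,X_2$ be arbitrarily dependent random variables with distributions $F_1,F_2$ respectively, such that $F_1\in\mathcal{T}$ and either $F_2\in\mathcal{T}$, or $\overline{F}_2(x)=o[\overline{F}_1(x)]$ as $x\to\infty$ and $F_2\in\mathcal{P_D}$. Then for any $p\in(0,1)$, $pF_1+(1-p)F_2\in\mathcal{T}$.
   Context: For a distribution $F$ write $\overline{F}:=1-F$; throughout $\overline{F}(x)>0$ for all $x\ge 0$. $F\in\mathcal{L}$ (long tailed) if for all (equivalently, for some) $a>0$, $\lim_{x\to\infty}\overline{F}(x-a)/\overline{F}(x)=1$. $F\in\mathcal{P_D}$ (positively decreasing) if for all (equivalently, for some) $v>1$, $\limsup_{x\to\infty}\overline{F}(vx)/\overline{F}(x)<1$. $\mathcal{T}:=\mathcal{L}\cap\mathcal{P_D}$. *)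

theory Defs
  imports "HOL-Probability.Probability" "HOL-Library.Landau_Symbols"
begin

definition tail :: "(real \<Rightarrow> real) \<Rightarrow> real \<Rightarrow> real" where
  "tail F x = 1 - F x"

text \<open>Distribution functions on the real line, with the standing assumption that the tail is
  positive on the nonnegative half-line (hence everywhere, by monotonicity).\<close>

definition distribution_functions :: "(real \<Rightarrow> real) set" where
  "distribution_functions =
     {F. (\<exists>\<mu>. real_distribution \<mu> \<and> F = cdf \<mu>) \<and> (\<forall>x\<ge>0. tail F x > 0)}"

definition long_tailed :: "(real \<Rightarrow> real) set" where
  "long_tailed = {F \<in> distribution_functions.
     \<forall>a>0. ((\<lambda>x. tail F (x - a) / tail F x) \<longlongrightarrow> 1) at_top}"

text \<open>The quantifier over \<open>v\<close> is universal. Requiring the inequality for some \<open>v > 1\<close> only would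
  give a larger class: it passes to larger \<open>v\<close>, but not to smaller ones. For example, if
  the tail at \<open>x \<ge> 1\<close> is \<open>2 powr (- of_int \<lfloor>log 2 x\<rfloor> - 1)\<close>, the quotient is constantly 1/2 for
  \<open>v = 2\<close>, but its limit superior is 1 for every \<open>v\<close> strictly between 1 and 2.\<close>

definition positively_decreasing :: "(real \<Rightarrow> real) set" where
  "positively_decreasing = {F \<in> distribution_functions.
     \<forall>v>1. Limsup at_top (\<lambda>x. ereal (tail F (v * x) / tail F x)) < 1}"

definition class_T :: "(real \<Rightarrow> real) set" where
  "class_T = long_tailed \<inter> positively_decreasing"

definition mixture :: "real \<Rightarrow> (real \<Rightarrow> real) \<Rightarrow> (real \<Rightarrow> real) \<Rightarrow> real \<Rightarrow> real" where
  "mixture p F G x = p * F x + (1 - p) * G x"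

end

theory Submission
  imports Defs
begin

text \<open>The tail of the mixture \<open>H\<close> is \<open>p * tail F + (1 - p) * tail G\<close>, so its quotients
  \<open>tail H y / tail H x\<close> are mediants of the corresponding quotients of \<open>F\<close> and \<open>G\<close>: averages of
  these two quotients with positive weights that depend on \<open>x\<close>. A mediant does not exceed the
  larger of the two quotients. Taking \<open>y = v * x\<close>, an eventual bound below 1 for each component
  is inherited by the mixture, which gives part (1). Taking \<open>y = x - a\<close>, a mediant is also
  squeezed to 1 when both quotients tend to 1, which gives part (2) if both components are
  long tailed.

  If the second tail is negligible, its own quotients need not converge. In that case the tail
  of the mixture is asymptotically \<open>p\<close> times the tail of the first component, and the limit of
  \<open>tail F (x - a) / tail F x\<close> is invariant under asymptotic proportionality.\<close>

section \<open>Mixtures of distribution functions\<close>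

lemma tail_mixture: "tail (mixture p F G) x = p * tail F x + (1 - p) * tail G x"
  by (simp add: tail_def mixture_def algebra_simps)

text \<open>A real function is a distribution function when it is nondecreasing, right continuous and
  has limits 0 and 1 at the two ends; convex combinations preserve each of these.\<close>

lemma mixture_distribution_function:
  assumes F: "F \<in> distribution_functions" and G: "G \<in> distribution_functions"
    and p: "0 < p" "p < 1"
  shows "mixture p F G \<in> distribution_functions"
proof -
  obtain \<mu> \<nu> where \<mu>: "real_distribution \<mu>" "F = cdf \<mu>" and \<nu>: "real_distribution \<nu>" "G = cdf \<nu>"
    using F G by (auto simp: distribution_functions_def)
  interpret \<mu>: real_distribution \<mu> by fact
  interpret \<nu>: real_distribution \<nu> by fact
  have mix: "mixture p F G = (\<lambda>x. p * cdf \<mu> x + (1 - p) * cdf \<nu> x)"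
    by (simp add: fun_eq_iff mixture_def \<mu> \<nu>)
  have mono: "mixture p F G x \<le> mixture p F G y" if "x \<le> y" for x y
    unfolding mix using p that
    by (intro add_mono mult_left_mono \<mu>.cdf_nondecreasing \<nu>.cdf_nondecreasing) auto
  have right_cont: "continuous (at_right x) (mixture p F G)" for x
    unfolding mix by (intro continuous_intros \<mu>.cdf_is_right_cont \<nu>.cdf_is_right_cont)
  have at_bot: "(mixture p F G \<longlongrightarrow> 0) at_bot"
    unfolding mix by (rule tendsto_eq_intros \<mu>.cdf_lim_at_bot \<nu>.cdf_lim_at_bot refl | simp)+
  have at_top: "(mixture p F G \<longlongrightarrow> 1) at_top"
    unfolding mix
    by (rule tendsto_eq_intros \<mu>.cdf_lim_at_top_prob \<nu>.cdf_lim_at_top_prob refl | simp)+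
  have "real_distribution (interval_measure (mixture p F G))"
    and "cdf (interval_measure (mixture p F G)) = mixture p F G"
    using mono right_cont at_bot at_top
    by (blast intro: real_distribution_interval_measure cdf_interval_measure)+
  moreover have "tail (mixture p F G) x > 0" if "x \<ge> 0" for x
    using that F G p by (simp add: tail_mixture distribution_functions_def add_pos_pos)
  ultimately show ?thesis
    unfolding distribution_functions_def
    by (auto intro!: exI[of _ "interval_measure (mixture p F G)"])
qed

section \<open>Positive decrease\<close>

text \<open>The strict bound on the limit superior leaves room for a real constant below 1, in which
  form the condition can be combined for two components.\<close>

lemma Limsup_ereal_less_one_iff:
  fixes f :: "'b \<Rightarrow> real"
  shows "Limsup A (\<lambda>x. ereal (f x)) < 1 \<longleftrightarrow> (\<exists>c<1. eventually (\<lambda>x. f x \<le> c) A)"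
proof
  assume "Limsup A (\<lambda>x. ereal (f x)) < 1"
  then obtain c where "Limsup A (\<lambda>x. ereal (f x)) < ereal c" "ereal c < 1"
    using ereal_dense2 by blast
  then have "eventually (\<lambda>x. f x \<le> c) A" "c < 1"
    by (auto dest!: Limsup_lessD elim: eventually_mono)
  then show "\<exists>c<1. eventually (\<lambda>x. f x \<le> c) A" by blast
next
  assume "\<exists>c<1. eventually (\<lambda>x. f x \<le> c) A"
  then obtain c where c: "c < 1" "eventually (\<lambda>x. f x \<le> c) A" by blast
  from c(2) have "Limsup A (\<lambda>x. ereal (f x)) \<le> ereal c"
    by (intro Limsup_bounded) (auto elim: eventually_mono)
  also have "ereal c < 1" using c(1) by simp
  finally show "Limsup A (\<lambda>x. ereal (f x)) < 1" .
qed

lemma mediant_le_max: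
  fixes a b c d p q :: real
  assumes "p > 0" "q > 0" "c > 0" "d > 0"
  shows "(p * a + q * b) / (p * c + q * d) \<le> max (a / c) (b / d)"
proof -
  let ?m = "max (a / c) (b / d)"
  have "a \<le> ?m * c" "b \<le> ?m * d"
    using assms by (simp_all flip: pos_divide_le_eq)
  then have "p * a + q * b \<le> p * (?m * c) + q * (?m * d)"
    using assms by (intro add_mono mult_left_mono) auto
  also have "\<dots> = ?m * (p * c + q * d)"
    by (simp add: algebra_simps)
  finally show ?thesis
    using assms by (simp add: pos_divide_le_eq add_pos_pos)
qed

lemma mixture_positively_decreasing:
  assumes F: "F \<in> positively_decreasing" and G: "G \<in> positively_decreasing"
    and p: "0 < p" "p < 1"
  shows "mixture p F G \<in> positively_decreasing"
proof -
  have df: "F \<in> distribution_functions" "G \<in> distribution_functions"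
    using F G by (auto simp: positively_decreasing_def)
  have "\<exists>c<1. \<forall>\<^sub>F x in at_top. tail (mixture p F G) (v * x) / tail (mixture p F G) x \<le> c"
    if v: "v > 1" for v
  proof -
    obtain c d where c: "c < 1" "\<forall>\<^sub>F x in at_top. tail F (v * x) / tail F x \<le> c"
      and d: "d < 1" "\<forall>\<^sub>F x in at_top. tail G (v * x) / tail G x \<le> d"
      using F G v unfolding positively_decreasing_def mem_Collect_eq Limsup_ereal_less_one_iff
      by blast
    have "\<forall>\<^sub>F x in at_top. tail (mixture p F G) (v * x) / tail (mixture p F G) x \<le> max c d"
      using c(2) d(2) eventually_ge_at_top[of 0]
    proof eventually_elim
      case (elim x)
      then have "tail F x > 0" "tail G x > 0"
        using df by (auto simp: distribution_functions_def)
      then have "tail (mixture p F G) (v * x) / tail (mixture p F G) x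
          \<le> max (tail F (v * x) / tail F x) (tail G (v * x) / tail G x)"
        unfolding tail_mixture using p by (intro mediant_le_max) auto
      also have "\<dots> \<le> max c d" using elim by (intro max.mono)
      finally show ?case .
    qed
    then show ?thesis using c(1) d(1) by (intro exI[of _ "max c d"]) simp
  qed
  then show ?thesis
    using mixture_distribution_function[OF df p]
    unfolding positively_decreasing_def mem_Collect_eq Limsup_ereal_less_one_iff by blast
qed

section \<open>Long tails\<close>

text \<open>Negating both numerators turns the upper bound for mediants into the lower bound.\<close>

lemma min_le_mediant:
  fixes a b c d p q :: real
  assumes "p > 0" "q > 0" "c > 0" "d > 0"
  shows "min (a / c) (b / d) \<le> (p * a + q * b) / (p * c + q * d)"
proof -
  have "- ((p * a + q * b) / (p * c + q * d)) = (p * (- a) + q * (- b)) / (p * c + q * d)"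
    by (simp add: minus_divide_left)
  also have "\<dots> \<le> max (- a / c) (- b / d)"
    by (rule mediant_le_max[OF assms])
  also have "\<dots> = - min (a / c) (b / d)"
    by (simp add: minus_min_eq_max)
  finally show ?thesis by simp
qed

lemma mixture_long_tailed:
  assumes F: "F \<in> long_tailed" and G: "G \<in> long_tailed" and p: "0 < p" "p < 1"
  shows "mixture p F G \<in> long_tailed"
proof -
  have df: "F \<in> distribution_functions" "G \<in> distribution_functions"
    using F G by (auto simp: long_tailed_def)
  have pos: "\<forall>\<^sub>F x in at_top. tail F x > 0 \<and> tail G x > 0"
    using eventually_ge_at_top[of "0::real"]
    by eventually_elim (use df in \<open>auto simp: distribution_functions_def\<close>)
  have "((\<lambda>x. tail (mixture p F G) (x - a) / tail (mixture p F G) x) \<longlongrightarrow> 1) at_top"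
    if a: "a > 0" for a
  proof (rule tendsto_sandwich)
    have lim: "((\<lambda>x. tail F (x - a) / tail F x) \<longlongrightarrow> 1) at_top"
      "((\<lambda>x. tail G (x - a) / tail G x) \<longlongrightarrow> 1) at_top"
      using F G a by (auto simp: long_tailed_def)
    show "((\<lambda>x. min (tail F (x - a) / tail F x) (tail G (x - a) / tail G x)) \<longlongrightarrow> 1) at_top"
      using tendsto_min[OF lim] by simp
    show "((\<lambda>x. max (tail F (x - a) / tail F x) (tail G (x - a) / tail G x)) \<longlongrightarrow> 1) at_top"
      using tendsto_max[OF lim] by simp
  next
    show "\<forall>\<^sub>F x in at_top. min (tail F (x - a) / tail F x) (tail G (x - a) / tail G x)
        \<le> tail (mixture p F G) (x - a) / tail (mixture p F G) x"
      using pos unfolding tail_mixture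
      by eventually_elim (use p in \<open>auto intro!: min_le_mediant\<close>)
    show "\<forall>\<^sub>F x in at_top. tail (mixture p F G) (x - a) / tail (mixture p F G) x
        \<le> max (tail F (x - a) / tail F x) (tail G (x - a) / tail G x)"
      using pos unfolding tail_mixture
      by eventually_elim (use p in \<open>auto intro!: mediant_le_max\<close>)
  qed
  then show ?thesis
    using mixture_distribution_function[OF df p] by (simp add: long_tailed_def)
qed

text \<open>The quotient \<open>tail H (x - a) / tail H x\<close> is the product of \<open>tail H (x - a) / tail F (x - a)\<close>,
  \<open>tail F (x - a) / tail F x\<close> and \<open>tail F x / tail H x\<close>, which tend to \<open>k\<close>, 1 and \<open>1 / k\<close>.\<close>

lemma long_tailed_if_tail_proportional:
  assumes F: "F \<in> long_tailed" and H: "H \<in> distribution_functions"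
    and k: "((\<lambda>x. tail H x / tail F x) \<longlongrightarrow> k) at_top" "k \<noteq> 0"
  shows "H \<in> long_tailed"
proof -
  have "((\<lambda>x. tail H (x - a) / tail H x) \<longlongrightarrow> 1) at_top" if a: "a > 0" for a
  proof -
    have lim: "((\<lambda>x. tail F (x - a) / tail F x) \<longlongrightarrow> 1) at_top"
      using F a by (simp add: long_tailed_def)
    have "filterlim (\<lambda>x. x - a) at_top at_top"
      using filterlim_tendsto_add_at_top[OF tendsto_const filterlim_ident, of "-a"] by simp
    then have shift: "((\<lambda>x. tail H (x - a) / tail F (x - a)) \<longlongrightarrow> k) at_top"
      by (rule filterlim_compose[OF k(1)])
    have "((\<lambda>x. tail H (x - a) / tail F (x - a) * (tail F (x - a) / tail F x)
        / (tail H x / tail F x)) \<longlongrightarrow> k * 1 / k) at_top"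
      using k(2) by (intro tendsto_divide tendsto_mult shift lim k(1))
    then have "((\<lambda>x. tail H (x - a) / tail F (x - a) * (tail F (x - a) / tail F x)
        / (tail H x / tail F x)) \<longlongrightarrow> 1) at_top"
      by (simp only: mult_1_right divide_self[OF k(2)])
    moreover have "\<forall>\<^sub>F x in at_top. tail H (x - a) / tail F (x - a) * (tail F (x - a) / tail F x)
        / (tail H x / tail F x) = tail H (x - a) / tail H x"
      \<comment> \<open>Both \<open>x\<close> and \<open>x - a\<close> must be nonnegative, where tails are known to be positive.\<close>
      using eventually_ge_at_top[of a]
    proof eventually_elim
      case (elim x)
      then have "tail F (x - a) > 0" "tail F x > 0"
        using F a by (auto simp: long_tailed_def distribution_functions_def)
      then show ?case by simp
    qed
    ultimately show ?thesis
      by (rule Lim_transform_eventually)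
  qed
  then show ?thesis using H by (simp add: long_tailed_def)
qed

lemma mixture_long_tailed_if_negligible:
  assumes F: "F \<in> long_tailed" and G: "G \<in> distribution_functions"
    and small: "tail G \<in> o[at_top](tail F)" and p: "0 < p" "p < 1"
  shows "mixture p F G \<in> long_tailed"
proof (rule long_tailed_if_tail_proportional[OF F])
  have df: "F \<in> distribution_functions" using F by (simp add: long_tailed_def)
  show "mixture p F G \<in> distribution_functions"
    by (rule mixture_distribution_function[OF df G p])
  have "((\<lambda>x. p + (1 - p) * (tail G x / tail F x)) \<longlongrightarrow> p + (1 - p) * 0) at_top"
    by (intro tendsto_intros smalloD_tendsto small)
  moreover have "\<forall>\<^sub>F x in at_top. p + (1 - p) * (tail G x / tail F x)
      = tail (mixture p F G) x / tail F x"
    using eventually_ge_at_top[of 0]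
  proof eventually_elim
    case (elim x)
    then have "tail F x > 0" using df by (simp add: distribution_functions_def)
    then show ?case by (simp add: tail_mixture field_simps)
  qed
  ultimately show "((\<lambda>x. tail (mixture p F G) x / tail F x) \<longlongrightarrow> p) at_top"
    by (simp add: tendsto_cong)
  show "p \<noteq> 0" using p by simp
qed

section \<open>Closure under mixtures\<close>

theorem proposition3p1:
  fixes M :: "'a measure" and X1 X2 :: "'a \<Rightarrow> real" and F1 F2 :: "real \<Rightarrow> real"
  assumes "prob_space M"
    and "X1 \<in> borel_measurable M" and "X2 \<in> borel_measurable M"
    and "F1 = cdf (distr M borel X1)" and "F2 = cdf (distr M borel X2)"
    and "\<forall>x\<ge>0. tail F1 x > 0" and "\<forall>x\<ge>0. tail F2 x > 0"
  shows "(F1 \<in> positively_decreasing \<and> F2 \<in> positively_decreasing \<longrightarrow>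
            (\<forall>p\<in>{0<..<1}. mixture p F1 F2 \<in> positively_decreasing)) \<and>
         (F1 \<in> class_T \<and>
            (F2 \<in> class_T \<or> (tail F2 \<in> o[at_top](tail F1) \<and> F2 \<in> positively_decreasing)) \<longrightarrow>
            (\<forall>p\<in>{0<..<1}. mixture p F1 F2 \<in> class_T))"
proof (intro conjI impI ballI)
  fix p :: real assume "p \<in> {0<..<1}"
  then have p: "0 < p" "p < 1" by auto
  show "mixture p F1 F2 \<in> positively_decreasing"
    if "F1 \<in> positively_decreasing \<and> F2 \<in> positively_decreasing"
    using that p by (blast intro: mixture_positively_decreasing)
  assume T: "F1 \<in> class_T \<and>
    (F2 \<in> class_T \<or> (tail F2 \<in> o[at_top](tail F1) \<and> F2 \<in> positively_decreasing))"
  then have "mixture p F1 F2 \<in> positively_decreasing"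
    using p by (auto simp: class_T_def intro: mixture_positively_decreasing)
  moreover have "mixture p F1 F2 \<in> long_tailed"
  proof (cases "F2 \<in> class_T")
    case True
    then show ?thesis using T p by (auto simp: class_T_def intro: mixture_long_tailed)
  next
    case False
    then have "F2 \<in> distribution_functions"
      using T by (auto simp: positively_decreasing_def)
    then show ?thesis
      using False T p by (auto simp: class_T_def intro: mixture_long_tailed_if_negligible)
  qed
  ultimately show "mixture p F1 F2 \<in> class_T" by (simp add: class_T_def)
qed

end
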